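(* Let $q$ be a power of $2$. Then a unipotent element of type $(3,1)$ in $\mathrm{U}(4,\mathbb{F}_q)$ is strongly real in $\mathrm{U}(4,\mathbb{F}_q)$.
   Context: For a prime power $q$ write $\bar a=a^q$ for $a\in\mathbb{F}_{q^2}$, and apply the bar entrywise to matrices. The finite unitary group is $\mathrm{U}(n,\mathbb{F}_q)=\{g\in \mathrm{GL}(n,\mathbb{F}_{q^2}) : {}^{\top}\bar g\, g=I_n\}$; up to isomorphism it is the isometry group of any non-degenerate Hermitian form on an $n$-dimensional $\mathbb{F}_{q^2}$-vector space. An element $g$ of a group $G$ is strongly real in $G$ if there is $s\in G$ with $s^2=1$ and $sgs=g^{-1}$. A unipotent element is of type $\mu$, for a partition $\mu$ of $n$, if its Jordan block sizes are the parts of $\mu$; the unipotent elements of type $\mu$ form a single conjugacy class of $\mathrm{U}(n,\mathbb{F}_q)$. *)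

theory Defs
  imports
    "Jordan_Normal_Form.Jordan_Normal_Form"
    "HOL-Library.Cardinality"
begin

definition strongly_real :: "('a, 'b) monoid_scheme \<Rightarrow> 'a \<Rightarrow> bool" where
  "strongly_real G g \<longleftrightarrow>
     (\<exists>s \<in> carrier G. s \<otimes>\<^bsub>G\<^esub> s = \<one>\<^bsub>G\<^esub> \<and> s \<otimes>\<^bsub>G\<^esub> g \<otimes>\<^bsub>G\<^esub> s = inv\<^bsub>G\<^esub> g)"

definition general_linear_group :: "nat \<Rightarrow> 'a :: field mat monoid" where
  "general_linear_group n = units_of (ring_mat TYPE('a) n ())"

text \<open>The map \<open>a \<mapsto> a ^ q\<close> is the bar of \<open>\<bbbF>\<^bsub>q\<^sup>2\<^esub>\<close>, and the following is the unitary group,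
  only when \<open>q\<close> is a prime power and \<open>'a\<close> is a field with \<open>q\<^sup>2\<close> elements.\<close>

definition bar_mat :: "nat \<Rightarrow> 'a :: field mat \<Rightarrow> 'a mat" where
  "bar_mat q = map_mat (\<lambda>a. a ^ q)"

definition unitary_group :: "nat \<Rightarrow> nat \<Rightarrow> 'a :: field mat monoid" where
  "unitary_group n q = (general_linear_group n)
     \<lparr>carrier := {g \<in> carrier (general_linear_group n).
        transpose_mat (bar_mat q g) * g = 1\<^sub>m n}\<rparr>"

definition unipotent_mat :: "'a :: field mat \<Rightarrow> bool" where
  "unipotent_mat A \<longleftrightarrow> square_mat A \<and>
     (\<exists>k. (A - 1\<^sub>m (dim_row A)) ^\<^sub>m k = 0\<^sub>m (dim_row A) (dim_row A))"

text \<open>A partition is represented by the multiset of its parts; \<^const>\<open>jordan_nf\<close> excludes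
  blocks of size 0, and forces the block sizes to add up to the dimension of the matrix.\<close>

definition unipotent_of_type :: "nat multiset \<Rightarrow> 'a :: field mat \<Rightarrow> bool" where
  "unipotent_of_type \<mu> A \<longleftrightarrow> unipotent_mat A \<and>
     (\<exists>n_as. jordan_nf A n_as \<and> mset (map fst n_as) = \<mu>)"

end

theory Submission
  imports Defs "Jordan_Normal_Form.Jordan_Normal_Form_Uniqueness"
begin

text \<open>
Write \<open>h\<close> for the Hermitian form and \<open>N = g - 1\<close>. For a unipotent \<open>g\<close>, the type \<open>(3,1)\<close> means
\<open>N\<^sup>3 = 0 \<noteq> N\<^sup>2\<close> (\<open>unipotent_of_type_pow_zero_iff\<close>). In characteristic 2 the
inverse of \<open>g\<close> is \<open>1 + N + N\<^sup>2\<close>, so the adjoint of \<open>N\<close> is \<open>N + N\<^sup>2\<close> (\<open>form_nu_left\<close>).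

The space has a basis \<open>v, Nv, N\<^sup>2v, w\<close> in which the form and \<open>g\<close> depend on very little. Since \<open>N\<^sup>2\<close> is
self-adjoint and nonzero, some \<open>v\<close> has \<open>h(v, N\<^sup>2v) = 1\<close> (\<open>obtain_cyclic_vector\<close>). The
span of \<open>v, Nv, N\<^sup>2v\<close> is nondegenerate and \<open>g\<close>-invariant; its orthogonal complement is a line on which
\<open>N\<close> vanishes, spanned by a vector \<open>w\<close> with \<open>h(w, w) = 1\<close> (\<open>obtain_orthogonal_vector\<close>,
\<open>anisotropic_w\<close>). The scalings are possible because every element of the fixed field is a
square. The Gram matrix now involves only \<open>h(v, v)\<close> and \<open>b = h(v, Nv)\<close>, and the formula for
the adjoint gives \<open>b + b\<^sup>q = h(v, N\<^sup>2v) = 1\<close> (\<open>trace_b\<close>).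

A linear map \<open>s\<close> with \<open>sgs = g\<^sup>-\<^sup>1\<close> and \<open>s\<^sup>2 = 1\<close> satisfies \<open>sN = (N + N\<^sup>2)s\<close>, so it is determined by
\<open>sv\<close> and \<open>sw\<close>. On the three-dimensional block alone none is an isometry: if \<open>\<beta>\<close> is the coefficient
of \<open>Nv\<close> in \<open>sv\<close>, then \<open>h(sv, sNv) = h(v, Nv)\<close> requires \<open>\<beta> + \<beta>\<^sup>q = 1\<close>, but \<open>s\<^sup>2v\<close> is
\<open>v + (\<beta>\<^sup>2 + \<beta>)N\<^sup>2v\<close>, where \<open>\<beta>\<^sup>2 + \<beta> = \<beta> \<beta>\<^sup>q \<noteq> 0\<close>. The extra vector \<open>w\<close> repairs this: adding
\<open>\<delta>w\<close> to \<open>sv\<close> and \<open>\<epsilon>N\<^sup>2v\<close> to \<open>sw\<close> changes \<open>s\<^sup>2v\<close> by \<open>\<delta>\<epsilon>N\<^sup>2v\<close>, and orthogonality of \<open>sv\<close> and \<open>sw\<close>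
requires \<open>\<delta> = \<epsilon>\<^sup>q\<close>. With \<open>\<beta> = \<epsilon> = b\<close> and \<open>\<delta> = b\<^sup>q\<close> the two terms cancel, and the map

  \<open>v \<mapsto> v + b Nv + b N\<^sup>2v + b\<^sup>q w\<close>,  \<open>Nv \<mapsto> Nv + b\<^sup>q N\<^sup>2v\<close>,  \<open>N\<^sup>2v \<mapsto> N\<^sup>2v\<close>,  \<open>w \<mapsto> w + b N\<^sup>2v\<close>

is an involutive isometry that inverts \<open>g\<close>. That is a computation with explicit matrices
(\<open>model_involution_square\<close>, \<open>model_involution_inverts\<close>, \<open>model_involution_isometry\<close>).
\<close>

section \<open>Nilpotency and the sizes of Jordan blocks\<close>

lemma four_block_diag_zero_iff:
  assumes A: "A \<in> carrier_mat n n" and B: "B \<in> carrier_mat m m"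
  shows "four_block_mat A (0\<^sub>m n m) (0\<^sub>m m n) B = 0\<^sub>m (n + m) (n + m) \<longleftrightarrow>
    A = 0\<^sub>m n n \<and> B = (0\<^sub>m m m :: 'a :: zero mat)"
proof
  assume eq: "four_block_mat A (0\<^sub>m n m) (0\<^sub>m m n) B = 0\<^sub>m (n + m) (n + m)"
  have "A $$ (i, j) = 0" if "i < n" "j < n" for i j
    using arg_cong[OF eq, of "\<lambda>M. M $$ (i, j)"] that A B by simp
  moreover have "B $$ (i, j) = 0" if "i < m" "j < m" for i j
    using arg_cong[OF eq, of "\<lambda>M. M $$ (n + i, n + j)"] that A B by simp
  ultimately show "A = 0\<^sub>m n n \<and> B = 0\<^sub>m m m"
    using A B by (auto intro!: eq_matI)
next
  assume "A = 0\<^sub>m n n \<and> B = 0\<^sub>m m m"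
  then show "four_block_mat A (0\<^sub>m n m) (0\<^sub>m m n) B = 0\<^sub>m (n + m) (n + m)"
    by (auto intro!: eq_matI)
qed

text \<open>The corner entries decide the matter: the diagonal of the power is \<open>e ^ r\<close>, and for \<open>e = 0\<close> the
power is the \<open>r\<close>-th superdiagonal of ones, which is absent exactly if \<open>n \<le> r\<close>.\<close>

lemma jordan_block_pow_zero_iff:
  fixes e :: "'a :: field"
  assumes n: "n > 0"
  shows "jordan_block n e ^\<^sub>m r = 0\<^sub>m n n \<longleftrightarrow> e = 0 \<and> n \<le> r"
proof
  assume eq: "jordan_block n e ^\<^sub>m r = 0\<^sub>m n n"
  have "(jordan_block n e ^\<^sub>m r) $$ (0, 0) = e ^ r"
    unfolding jordan_block_pow using n by simp
  then have e: "e = 0"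
    using eq n by simp
  have "n \<le> r"
  proof (rule ccontr)
    assume "\<not> n \<le> r"
    then have "(jordan_block n e ^\<^sub>m r) $$ (0, r) = 1"
      unfolding jordan_block_pow using n by simp
    then show False
      using eq \<open>\<not> n \<le> r\<close> by simp
  qed
  with e show "e = 0 \<and> n \<le> r" by simp
next
  assume "e = 0 \<and> n \<le> r"
  then show "jordan_block n e ^\<^sub>m r = 0\<^sub>m n n"
    unfolding jordan_block_pow by (auto intro!: eq_matI)
qed

lemma jordan_matrix_char_pow_zero_iff:
  fixes e :: "'a :: field"
  assumes "0 \<notin> fst ` set n_as"
  defines "d \<equiv> sum_list (map fst n_as)"
  shows "char_matrix (jordan_matrix n_as) e ^\<^sub>m r = 0\<^sub>m d d \<longleftrightarrow>
    (\<forall>(n, a) \<in> set n_as. a = e \<and> n \<le> r)"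
  unfolding d_def using assms(1)
proof (induction n_as)
  case Nil
  show ?case by (auto intro!: eq_matI simp: jordan_matrix_def char_matrix_def)
next
  case (Cons na n_as)
  obtain n a where na: "na = (n, a)" by force
  let ?d = "sum_list (map fst n_as)"
  let ?B = "char_matrix (jordan_block n a) e"
  let ?C = "char_matrix (jordan_matrix n_as) e"
  have C: "?C \<in> carrier_mat ?d ?d" by simp
  have J: "jordan_matrix (na # n_as) =
      four_block_mat (jordan_block n a) (0\<^sub>m n ?d) (0\<^sub>m ?d n) (jordan_matrix n_as)"
    using jordan_matrix_dim[of n_as] by (simp add: na jordan_matrix_def Let_def)
  have "char_matrix (jordan_matrix (na # n_as)) e =
      four_block_mat ?B (0\<^sub>m n ?d) (0\<^sub>m ?d n) ?C"
    unfolding J char_matrix_def by (intro eq_matI) auto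
  then have "char_matrix (jordan_matrix (na # n_as)) e ^\<^sub>m r =
      four_block_mat (?B ^\<^sub>m r) (0\<^sub>m n ?d) (0\<^sub>m ?d n) (?C ^\<^sub>m r)"
    using pow_four_block_mat[OF _ C, of ?B n r] by simp
  then have "char_matrix (jordan_matrix (na # n_as)) e ^\<^sub>m r = 0\<^sub>m (n + ?d) (n + ?d) \<longleftrightarrow>
      ?B ^\<^sub>m r = 0\<^sub>m n n \<and> ?C ^\<^sub>m r = 0\<^sub>m ?d ?d"
    using four_block_diag_zero_iff[of "?B ^\<^sub>m r" n "?C ^\<^sub>m r" ?d] C by simp
  moreover have "?B ^\<^sub>m r = 0\<^sub>m n n \<longleftrightarrow> a = e \<and> n \<le> r"
    unfolding char_matrix_jordan_block
    using jordan_block_pow_zero_iff[of n "a - e" r] Cons.prems na by simp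
  ultimately show ?case
    using Cons na by auto
qed

lemma jordan_nf_char_pow_zero_iff:
  fixes A :: "'a :: field mat"
  assumes A: "A \<in> carrier_mat d d" and jnf: "jordan_nf A n_as"
  shows "char_matrix A e ^\<^sub>m r = 0\<^sub>m d d \<longleftrightarrow> (\<forall>(n, a) \<in> set n_as. a = e \<and> n \<le> r)"
proof -
  let ?J = "jordan_matrix n_as"
  from jnf obtain P Q where wit: "similar_mat_wit A ?J P Q"
    by (auto simp: jordan_nf_def similar_mat_def)
  from similar_mat_witD2[OF A this] have J: "?J \<in> carrier_mat d d" by simp
  then have d: "sum_list (map fst n_as) = d"
    by (metis carrier_matD(1) jordan_matrix_dim(1))
  have wit_r: "similar_mat_wit (char_matrix A e ^\<^sub>m r) (char_matrix ?J e ^\<^sub>m r) P Q"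
    by (rule similar_mat_wit_pow[OF similar_mat_wit_char_matrix[OF wit]])
  have cA: "char_matrix A e ^\<^sub>m r \<in> carrier_mat d d" using A by simp
  have cJ: "char_matrix ?J e ^\<^sub>m r \<in> carrier_mat d d" using J by simp
  note D = similar_mat_witD2[OF cA wit_r] similar_mat_witD2[OF cJ similar_mat_wit_sym[OF wit_r]]
  have "char_matrix A e ^\<^sub>m r = 0\<^sub>m d d \<longleftrightarrow> char_matrix ?J e ^\<^sub>m r = 0\<^sub>m d d"
    using D by (metis left_mult_zero_mat right_mult_zero_mat)
  then show ?thesis
    using jordan_matrix_char_pow_zero_iff[of n_as e r] jnf d by (simp add: jordan_nf_def)
qed

text \<open>A unipotent matrix has \<open>1\<close> as its only eigenvalue, so its type is visible in the powers of \<open>A - 1\<close>.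
For the type \<open>(3,1)\<close> this gives nilpotency of index exactly 3.\<close>

lemma unipotent_of_type_pow_zero_iff:
  fixes A :: "'a :: field mat"
  assumes A: "A \<in> carrier_mat d d" and type: "unipotent_of_type \<mu> A"
  shows "(A - 1\<^sub>m d) ^\<^sub>m r = 0\<^sub>m d d \<longleftrightarrow> (\<forall>n \<in># \<mu>. n \<le> r)"
proof -
  obtain k n_as where k: "(A - 1\<^sub>m d) ^\<^sub>m k = 0\<^sub>m d d"
    and jnf: "jordan_nf A n_as" and \<mu>: "mset (map fst n_as) = \<mu>"
    using type A by (auto simp: unipotent_of_type_def unipotent_mat_def)
  have N: "A - 1\<^sub>m d = char_matrix A 1"
    using A by (auto intro!: eq_matI simp: char_matrix_def)
  have "\<forall>(n, a) \<in> set n_as. a = 1"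
    using k jordan_nf_char_pow_zero_iff[OF A jnf, of 1 k] unfolding N by auto
  then show ?thesis
    unfolding N jordan_nf_char_pow_zero_iff[OF A jnf] using \<mu> by force
qed

section \<open>The model matrices\<close>

lemma mat_of_rows_list_times:
  fixes rs ss :: "'a :: semiring_0 list list"
  assumes "length ss = n"
  shows "mat_of_rows_list n rs * mat_of_rows_list m ss =
    mat_of_rows_list m (map (\<lambda>r. map (\<lambda>j. \<Sum>l \<leftarrow> [0..<n]. r ! l * ss ! l ! j) [0..<m]) rs)"
  using assms
  by (intro eq_matI)
    (auto simp: mat_of_rows_list_def scalar_prod_def interv_sum_list_conv_sum_set_nat intro!: sum.cong)

abbreviation mat4 :: "'a list list \<Rightarrow> 'a mat" where
  "mat4 \<equiv> mat_of_rows_list 4"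

lemma upt_0_4: "[0..<4] = [0, 1, 2, 3]"
  by (simp add: eval_nat_numeral)

lemma mat4_carrier: "length rs = 4 \<Longrightarrow> mat4 rs \<in> carrier_mat 4 4"
  by (rule carrier_matI) (simp_all add: mat_of_rows_list_def)

lemma mat4_eqI:
  assumes "A \<in> carrier_mat 4 4" "B \<in> carrier_mat 4 4"
    and "\<And>i j. i \<in> {0, 1, 2, 3} \<Longrightarrow> j \<in> {0, 1, 2, 3} \<Longrightarrow> A $$ (i, j) = B $$ (i, j)"
  shows "A = B"
  using assms by (intro eq_matI) (auto simp: numeral_eq_Suc less_Suc_eq)

lemma one_mat4:
  "1\<^sub>m 4 = mat4 [[1, 0, 0, 0], [0, 1, 0, 0], [0, 0, 1, 0], [0, 0, 0, 1 :: 'a :: comm_semiring_1]]"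
  by (rule mat4_eqI) (auto simp: mat_of_rows_list_def)

lemma adjoint_mat4:
  fixes a0 :: "'a :: field"
  shows "transpose_mat (bar_mat q
      (mat4 [[a0, a1, a2, a3], [b0, b1, b2, b3], [c0, c1, c2, c3], [d0, d1, d2, d3]])) =
    mat4 [[a0 ^ q, b0 ^ q, c0 ^ q, d0 ^ q], [a1 ^ q, b1 ^ q, c1 ^ q, d1 ^ q],
          [a2 ^ q, b2 ^ q, c2 ^ q, d2 ^ q], [a3 ^ q, b3 ^ q, c3 ^ q, d3 ^ q]]"
  by (rule mat4_eqI) (auto simp: mat_of_rows_list_def bar_mat_def)

text \<open>The matrices of the Hermitian form, of \<open>g\<close>, and of the involution \<open>s\<close>, in a basis
\<open>v, Nv, N\<^sup>2v, w\<close> as above; \<open>c\<close> stands for the conjugate of \<open>b\<close>, and \<open>d\<close> for the norm of \<open>w\<close>, which will be 1. In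
\<open>sv = v + b Nv + b N\<^sup>2v + c w\<close> the coefficient of \<open>Nv\<close> has trace 1, as \<open>h(sv, sNv) = h(v, Nv)\<close>
requires, and the coefficient of \<open>N\<^sup>2v\<close> is there for \<open>h(sv, sv) = h(v, v)\<close>. The coefficients \<open>c\<close> and
\<open>b\<close> that mix \<open>v\<close> and \<open>w\<close> have the product \<open>b\<^sup>2 + b\<close>, which makes the square of \<open>s\<close> trivial.\<close>

definition model_gram :: "'a \<Rightarrow> 'a \<Rightarrow> 'a \<Rightarrow> 'a \<Rightarrow> 'a :: field mat" where
  "model_gram a b c d = mat4 [[a, b, 1, 0], [c, 1, 0, 0], [1, 0, 0, 0], [0, 0, 0, d]]"

definition model_unipotent :: "'a :: field mat" where
  "model_unipotent = mat4 [[1, 0, 0, 0], [1, 1, 0, 0], [0, 1, 1, 0], [0, 0, 0, 1]]"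

definition model_involution :: "'a \<Rightarrow> 'a \<Rightarrow> 'a :: field mat" where
  "model_involution b c = mat4 [[1, 0, 0, 0], [b, 1, 0, 0], [b, c, 1, b], [c, 0, 0, 1]]"

lemmas model_defs = model_gram_def model_unipotent_def model_involution_def

lemma model_carrier [simp]:
  "model_gram a b c d \<in> carrier_mat 4 4"
  "model_unipotent \<in> carrier_mat 4 4"
  "model_involution b c \<in> carrier_mat 4 4"
  by (simp_all add: model_defs mat4_carrier)

text \<open>Stated as rewrite rules: the first two make associative-commutative normalization cancel equal
summands, and the numerals are those that arithmetic produces when it collects like terms.\<close>

lemma char2_arith:
  assumes char2: "(1 :: 'a :: field) + 1 = 0"
  shows "x + x = (0 :: 'a)" "x + (x + y) = y" "(2 :: 'a) = 0" "(3 :: 'a) = 1"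
proof -
  show 0: "x + x = 0" for x :: 'a
    using distrib_right[of 1 1 x] unfolding char2 by simp
  show "x + (x + y) = y"
    unfolding add.assoc[symmetric] 0 by simp
  show 2: "(2 :: 'a) = 0" using char2 by simp
  have "(3 :: 'a) = 2 + 1" by simp
  then show "(3 :: 'a) = 1" unfolding 2 by simp
qed

context
  fixes a b c :: "'a :: field"
  assumes char2: "(1 :: 'a) + 1 = 0" and bc: "b + c = 1"
begin

lemma conj_eq: "c = b + 1"
  using bc char2_arith(2)[OF char2, of b c] by (simp add: add.commute)

lemma model_gram_inverse:
  "model_gram a b c 1 * mat4 [[0, 0, 1, 0], [0, 1, c, 0], [1, b, a + b * c, 0], [0, 0, 0, 1]] = 1\<^sub>m 4"
  by (simp add: model_defs mat_of_rows_list_times upt_0_4 one_mat4 char2_arith[OF char2] ac_simps)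

lemma model_involution_square: "model_involution b c * model_involution b c = 1\<^sub>m 4"
  by (simp add: model_defs mat_of_rows_list_times upt_0_4 one_mat4 char2_arith[OF char2] ac_simps)

lemma model_involution_inverts:
  "model_involution b c * model_unipotent * (model_involution b c * model_unipotent) = 1\<^sub>m 4"
  by (simp add: model_defs mat_of_rows_list_times upt_0_4 one_mat4)
    (simp add: char2_arith[OF char2] conj_eq algebra_simps)

lemma model_involution_isometry:
  assumes "q > 0" "b ^ q = c" "c ^ q = b"
  shows "transpose_mat (bar_mat q (model_involution b c)) * model_gram a b c 1 * model_involution b c =
    model_gram a b c 1"
  using assms(1)
  by (simp add: model_defs mat_of_rows_list_times upt_0_4 adjoint_mat4 assms(2,3) zero_power)
    (simp add: char2_arith[OF char2] conj_eq algebra_simps)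

end

section \<open>Hermitian forms over a field with conjugation in characteristic 2\<close>

lemma mult_mat_zero_vec:
  fixes A :: "'a :: semiring_0 mat"
  assumes "A \<in> carrier_mat n m"
  shows "A *\<^sub>v 0\<^sub>v m = 0\<^sub>v n"
  using assms by (intro eq_vecI) (auto simp: scalar_prod_def)

lemma zero_mat_mult_vec:
  fixes x :: "'a :: semiring_0 vec"
  assumes "x \<in> carrier_vec m"
  shows "0\<^sub>m n m *\<^sub>v x = 0\<^sub>v n"
  using assms by (intro eq_vecI) (auto simp: scalar_prod_def)

text \<open>Multiplication by \<open>x \<noteq> 0\<close> permutes the nonzero elements and hence preserves their product.\<close>

lemma finite_field_power_card:
  fixes x :: "'a :: {field, finite}"
  shows "x ^ CARD('a) = x"
proof (cases "x = 0")
  case True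
  then show ?thesis by (simp add: zero_power)
next
  case False
  have "(\<Prod>y \<in> UNIV - {0}. x * y) = \<Prod>(UNIV - {0 :: 'a})"
    by (rule prod.reindex_bij_witness[of _ "\<lambda>y. y / x" "\<lambda>y. x * y"]) (use False in auto)
  then have "x ^ card (UNIV - {0 :: 'a}) = 1"
    by (simp add: prod.distrib)
  then have "x * x ^ (CARD('a) - 1) = x"
    by simp
  then show ?thesis
    by (metis power_Suc Suc_pred' finite_UNIV_card_ge_0 finite)
qed

text \<open>The translation by \<open>1\<close> preserves the sum of all elements, but also adds the cardinality to it.\<close>

lemma of_nat_card_eq_zero: "of_nat CARD('a) = (0 :: 'a :: {field, finite})"
proof -
  have "(\<Sum>x \<in> (UNIV :: 'a set). x + 1) = (\<Sum>x \<in> UNIV. x)"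
    by (rule sum.reindex_bij_witness[of _ "\<lambda>x. x - 1" "\<lambda>x. x + 1"]) auto
  then show ?thesis by (simp add: sum.distrib)
qed

locale quadratic_field_char2 =
  fixes k q :: nat and ty :: "'a :: {field, finite} itself"
  assumes k: "k \<ge> 1" and q: "q = 2 ^ k" and card: "CARD('a) = q\<^sup>2"
begin

abbreviation bar :: "'a \<Rightarrow> 'a" where
  "bar x \<equiv> x ^ q"

lemma q_pos [simp]: "q > 0"
  by (simp add: q)

lemma char2: "(1 :: 'a) + 1 = 0"
proof -
  have "(2 :: 'a) ^ (2 * k) = of_nat CARD('a)"
    by (simp add: card q power_mult mult.commute)
  then have "(2 :: 'a) = 0"
    by (simp add: of_nat_card_eq_zero)
  then show ?thesis by simp
qed

lemmas char2_simps = char2_arith[OF char2]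

lemma bar_add: "bar (x + y) = bar x + bar y"
proof -
  have square: "(u + v)\<^sup>2 = u\<^sup>2 + v\<^sup>2" for u v :: 'a
    by (simp add: power2_sum char2_simps)
  have "(x + y) ^ (2 ^ m) = x ^ (2 ^ m) + y ^ (2 ^ m)" for m
  proof (induction m)
    case (Suc m)
    then show ?case
      by (simp only: power_Suc2 power_mult square)
  qed simp
  then show ?thesis by (simp only: q)
qed

lemma bar_bar [simp]: "bar (bar x) = x"
  using finite_field_power_card[of x] by (simp add: card power2_eq_square power_mult)

sublocale bar: comm_ring_hom bar
  by unfold_locales (simp_all add: bar_add power_mult_distrib zero_power)

text \<open>The bar is the \<open>k\<close>-th iterate of squaring, so on its fixed field the \<open>(k - 1)\<close>-th iterate inverts
squaring. On the fixed field the norm \<open>y \<mapsto> y bar y\<close> is squaring too; hence these roots are what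
scales a vector to norm 1.\<close>

lemma fixed_square_root:
  assumes "bar x = x"
  obtains y where "bar y = y" "y\<^sup>2 = x"
proof
  let ?y = "x ^ (2 ^ (k - 1))"
  have "bar ?y = bar x ^ (2 ^ (k - 1))"
    by (simp only: power_mult[symmetric] mult.commute)
  then show "bar ?y = ?y" by (simp only: assms)
  have "2 ^ (k - 1) * 2 = q"
    unfolding q using k power_minus_mult[of k "2 :: nat"] by linarith
  then show "?y\<^sup>2 = x"
    using assms by (simp only: power_mult[symmetric])
qed

text \<open>The polynomial \<open>X ^ q + X\<close> has at most \<open>q\<close> roots among the \<open>q\<^sup>2\<close> elements.\<close>

lemma nonzero_trace: obtains x where "x + bar x \<noteq> 0"
proof -
  have q2: "q \<ge> 2" using k by (cases k) (auto simp: q)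
  let ?p = "monom 1 q + monom 1 1 :: 'a poly"
  have p0: "coeff ?p q = 1" using q2 by simp
  have "degree ?p \<le> q"
    using q2 by (intro degree_add_le) (auto simp: degree_monom_eq)
  moreover have "?p \<noteq> 0" using p0 by (metis coeff_0 zero_neq_one)
  ultimately have "card {x. poly ?p x = 0} \<le> q"
    using card_poly_roots_bound[of ?p] by simp
  moreover have "CARD('a) > q"
    using q2 by (simp add: card power2_eq_square)
  ultimately have "{x. poly ?p x = 0} \<noteq> UNIV"
    by auto
  then show ?thesis
    using that by (auto simp: poly_monom add.commute)
qed

definition form :: "'a vec \<Rightarrow> 'a vec \<Rightarrow> 'a" where
  "form x y = map_vec bar x \<bullet> y"

lemma form_add:
  assumes "x \<in> carrier_vec n" "y \<in> carrier_vec n" "z \<in> carrier_vec n"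
  shows "form (x + y) z = form x z + form y z" "form z (x + y) = form z x + form z y"
proof -
  have "map_vec bar (x + y) = map_vec bar x + map_vec bar y"
    using assms by (auto simp: bar_add)
  then show "form (x + y) z = form x z + form y z"
    using assms by (simp add: form_def add_scalar_prod_distrib[of _ n])
  show "form z (x + y) = form z x + form z y"
    using assms by (simp add: form_def scalar_prod_add_distrib[of _ n])
qed

lemma form_smult:
  assumes "x \<in> carrier_vec n" "y \<in> carrier_vec n"
  shows "form (t \<cdot>\<^sub>v x) y = bar t * form x y" "form x (t \<cdot>\<^sub>v y) = t * form x y"
  using assms by (simp_all add: form_def bar.vec_hom_smult)

lemma bar_form:
  assumes "x \<in> carrier_vec n" "y \<in> carrier_vec n"
  shows "bar (form x y) = form y x"
proof -
  have "bar (form x y) = (\<Sum>i \<in> {0..<n}. x $ i * bar (y $ i))"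
    using assms by (simp add: form_def scalar_prod_def bar.hom_sum power_mult_distrib)
  also have "\<dots> = form y x"
    using assms by (auto simp: form_def scalar_prod_def mult.commute intro!: sum.cong)
  finally show ?thesis .
qed

abbreviation adj :: "'a mat \<Rightarrow> 'a mat" where
  "adj A \<equiv> transpose_mat (bar_mat q A)"

lemma bar_mat_carrier [simp]: "bar_mat q A \<in> carrier_mat n m \<longleftrightarrow> A \<in> carrier_mat n m"
  by (simp add: bar_mat_def)

lemma adj_carrier: "A \<in> carrier_mat n m \<Longrightarrow> adj A \<in> carrier_mat m n"
  by (simp add: bar_mat_def)

lemma adj_mult:
  assumes "A \<in> carrier_mat n m" "B \<in> carrier_mat m l"
  shows "adj (A * B) = adj B * adj A"
  using assms by (simp add: bar_mat_def bar.mat_hom_mult transpose_mult[of _ n m _ l])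

lemma adj_one [simp]: "adj (1\<^sub>m n) = 1\<^sub>m n"
  by (simp add: bar_mat_def bar.mat_hom_one)

lemma form_gram:
  assumes "A \<in> carrier_mat n m" "i < m" "j < m"
  shows "(adj A * A) $$ (i, j) = form (col A i) (col A j)"
  using assms by (simp add: bar_mat_def form_def col_map_mat)

lemma form_isometry:
  assumes A: "A \<in> carrier_mat n n" and unitary: "adj A * A = 1\<^sub>m n"
    and x: "x \<in> carrier_vec n" and y: "y \<in> carrier_vec n"
  shows "form (A *\<^sub>v x) (A *\<^sub>v y) = form x y"
proof -
  let ?B = "map_mat bar A"
  have B: "?B \<in> carrier_mat n n" and Bx: "map_vec bar x \<in> carrier_vec n"
    using A x by simp_all
  have Ay: "A *\<^sub>v y \<in> carrier_vec n" using A y by simp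
  have "form (A *\<^sub>v x) (A *\<^sub>v y) = (?B *\<^sub>v map_vec bar x) \<bullet> (A *\<^sub>v y)"
    by (simp only: form_def bar.mult_mat_vec_hom[OF A x])
  also have "\<dots> = map_vec bar x \<bullet> (transpose_mat ?B *\<^sub>v (A *\<^sub>v y))"
    using transpose_vec_mult_scalar[of "transpose_mat ?B" n n "A *\<^sub>v y" "map_vec bar x"]
      B Bx Ay by simp
  also have "transpose_mat ?B *\<^sub>v (A *\<^sub>v y) = (adj A * A) *\<^sub>v y"
    unfolding bar_mat_def
    by (rule assoc_mult_mat_vec[symmetric, OF _ A y]) (use B in simp)
  also have "\<dots> = y" using y unitary by simp
  finally show ?thesis by (simp only: form_def)
qed

end

section \<open>A frame adapted to the isometry\<close>

text \<open>The unipotent isometry is \<open>1 + N\<close>; only the action of \<open>N\<close> on vectors enters, hence the form of the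
condition \<open>N\<^sup>3 = 0\<close>.\<close>

locale unipotent_isometry = quadratic_field_char2 k q ty
  for k q :: nat and ty :: "'a :: {field, finite} itself" +
  fixes n :: nat and N :: "'a mat"
  assumes N [simp]: "N \<in> carrier_mat n n"
    and isometry: "adj (1\<^sub>m n + N) * (1\<^sub>m n + N) = 1\<^sub>m n"
    and cube: "x \<in> carrier_vec n \<Longrightarrow> N *\<^sub>v (N *\<^sub>v (N *\<^sub>v x)) = 0\<^sub>v n"
begin

abbreviation \<nu> :: "'a vec \<Rightarrow> 'a vec" where
  "\<nu> x \<equiv> N *\<^sub>v x"

lemma nu_carrier [simp]: "x \<in> carrier_vec n \<Longrightarrow> \<nu> x \<in> carrier_vec n"
  by (rule mult_mat_vec_carrier[OF N])

lemma nu_zero [simp]: "\<nu> (0\<^sub>v n) = 0\<^sub>v n"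
  by (rule mult_mat_zero_vec[OF N])

lemma unipotent_apply: "x \<in> carrier_vec n \<Longrightarrow> (1\<^sub>m n + N) *\<^sub>v x = x + \<nu> x"
  by (simp add: add_mult_distrib_mat_vec[of _ n n])

lemma form_zero_right: "x \<in> carrier_vec n \<Longrightarrow> form x (0\<^sub>v n) = 0"
  by (simp add: form_def)

lemma form_zero_left: "x \<in> carrier_vec n \<Longrightarrow> form (0\<^sub>v n) x = 0"
  using bar_form[of x n "0\<^sub>v n"] by (simp add: form_zero_right zero_power)

text \<open>This says that the adjoint of \<open>N\<close> is \<open>N + N\<^sup>2\<close>: the adjoint of \<open>1 + N\<close> is its inverse, which in
characteristic 2 is \<open>1 + N + N\<^sup>2\<close>.\<close>

lemma form_nu_left:
  assumes x: "x \<in> carrier_vec n" and y: "y \<in> carrier_vec n"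
  shows "form (\<nu> x) y = form x (\<nu> y) + form x (\<nu> (\<nu> y))"
proof -
  \<comment> \<open>The isometry condition, expanded; substituting it into itself stops because \<open>N\<^sup>3 = 0\<close>.\<close>
  have step: "form (\<nu> x) z = form x (\<nu> z) + form (\<nu> x) (\<nu> z)" if z: "z \<in> carrier_vec n" for z
  proof -
    have "form (x + \<nu> x) (z + \<nu> z) = form x z"
      using form_isometry[OF _ isometry x z] by (simp add: unipotent_apply x z)
    then have "form (\<nu> x) z + (form x (\<nu> z) + form (\<nu> x) (\<nu> z)) = 0"
      using x z by (simp add: form_add[of _ n] add.assoc add.left_commute)
    then show ?thesis
      by (metis char2_simps(2) add.right_neutral)
  qed
  have "form (\<nu> x) (\<nu> (\<nu> y)) = 0"
    using step[of "\<nu> (\<nu> y)"] x y by (simp add: cube form_zero_right)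
  then show ?thesis
    using step[of y] step[of "\<nu> y"] y by simp
qed

lemma form_nu_right:
  assumes "x \<in> carrier_vec n" "y \<in> carrier_vec n"
  shows "form x (\<nu> y) = form (\<nu> x) y + form (\<nu> (\<nu> x)) y"
  using assms by (simp add: form_nu_left cube form_zero_right char2_simps add.assoc)

lemma form_nu_nu:
  assumes "x \<in> carrier_vec n" "y \<in> carrier_vec n"
  shows "form (\<nu> x) (\<nu> y) = form x (\<nu> (\<nu> y))"
    and "form (\<nu> (\<nu> x)) y = form x (\<nu> (\<nu> y))"
    and "form (\<nu> x) (\<nu> (\<nu> y)) = 0"
    and "form (\<nu> (\<nu> x)) (\<nu> y) = 0"
    and "form (\<nu> (\<nu> x)) (\<nu> (\<nu> y)) = 0"
  using assms by (simp_all add: form_nu_left cube form_zero_right)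

lemma form_unit_vec:
  assumes "i < n" "x \<in> carrier_vec n"
  shows "form (unit_vec n i) x = x $ i"
proof -
  have "map_vec bar (unit_vec n i) = unit_vec n i"
    by (auto simp: unit_vec_def zero_power)
  then show ?thesis using assms by (simp add: form_def)
qed

text \<open>Since \<open>N\<^sup>2\<close> is its own adjoint, \<open>(x, y) \<mapsto> form x (N\<^sup>2 y)\<close> is a Hermitian form, and it is not zero. A
Hermitian form for which all vectors are isotropic vanishes by polarization, for which a scalar with
nonzero trace is needed. The value at an anisotropic vector lies in the fixed field, so that
vector can be scaled.\<close>

lemma obtain_cyclic_vector:
  assumes x: "x \<in> carrier_vec n" and nz: "\<nu> (\<nu> x) \<noteq> 0\<^sub>v n"
  obtains v where "v \<in> carrier_vec n" "form v (\<nu> (\<nu> v)) = 1"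
proof -
  have "\<exists>v \<in> carrier_vec n. form v (\<nu> (\<nu> v)) \<noteq> 0"
  proof (rule ccontr)
    assume "\<not> ?thesis"
    then have isotropic: "form v (\<nu> (\<nu> v)) = 0" if "v \<in> carrier_vec n" for v
      using that by blast
    obtain i where i: "i < n" "\<nu> (\<nu> x) $ i \<noteq> 0"
      using nz x by (metis eq_vecI index_zero_vec carrier_vecD nu_carrier)
    define y :: "'a vec" where "y = unit_vec n i"
    have y: "y \<in> carrier_vec n" by (simp add: y_def)
    define s where "s = form x (\<nu> (\<nu> y))"
    have bar_s: "bar s = form y (\<nu> (\<nu> x))"
      using x y by (simp add: s_def bar_form[of _ n] form_nu_nu)
    then have "bar s \<noteq> 0"
      using i x by (simp add: y_def form_unit_vec)
    then have s: "s \<noteq> 0" by (auto simp: zero_power)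
    obtain u where u: "u + bar u \<noteq> 0" by (rule nonzero_trace)
    \<comment> \<open>The scalar is chosen such that the polarized value is the nonzero trace of \<open>u\<close>.\<close>
    define t where "t = u / s"
    have ts: "t * s = u" using s by (simp add: t_def)
    have "form (x + t \<cdot>\<^sub>v y) (\<nu> (\<nu> (x + t \<cdot>\<^sub>v y))) = t * s + bar (t * s)"
      using x y isotropic[OF x] isotropic[OF y]
      by (simp add: mult_add_distrib_mat_vec[OF N] mult_mat_vec[OF N] form_add[of _ n]
          form_smult[of _ n] s_def[symmetric] bar_s[symmetric] power_mult_distrib)
    then show False
      using u isotropic[of "x + t \<cdot>\<^sub>v y"] x y ts by simp
  qed
  then obtain v where v: "v \<in> carrier_vec n" "form v (\<nu> (\<nu> v)) \<noteq> 0" by blast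
  have "bar (form v (\<nu> (\<nu> v))) = form v (\<nu> (\<nu> v))"
    using v by (simp add: bar_form[of _ n] form_nu_nu)
  then obtain r where r: "bar r = r" "r\<^sup>2 = form v (\<nu> (\<nu> v))"
    by (rule fixed_square_root)
  have r0: "r \<noteq> 0" using r(2) v(2) by auto
  show ?thesis
  proof (rule that)
    show "(1 / r) \<cdot>\<^sub>v v \<in> carrier_vec n" using v by simp
    have "form ((1 / r) \<cdot>\<^sub>v v) (\<nu> (\<nu> ((1 / r) \<cdot>\<^sub>v v))) = (1 / r) * ((1 / r) * r\<^sup>2)"
      using v by (simp add: mult_mat_vec[OF N] form_smult[of _ n] r power_one_over)
    then show "form ((1 / r) \<cdot>\<^sub>v v) (\<nu> (\<nu> ((1 / r) \<cdot>\<^sub>v v))) = 1"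
      using r0 by (simp add: power2_eq_square)
  qed
qed

end


text \<open>The norm of \<open>w\<close> is left open here: that it is nonzero is itself proved with the Gram matrix, and
only then can \<open>w\<close> be normalized.\<close>

locale unipotent_isometry_frame = unipotent_isometry k q ty 4 N
  for k q :: nat and ty :: "'a :: {field, finite} itself" and N :: "'a mat" +
  fixes v w :: "'a vec"
  assumes v [simp]: "v \<in> carrier_vec 4" and w [simp]: "w \<in> carrier_vec 4"
    and cyclic: "form v (\<nu> (\<nu> v)) = 1"
    and orthogonal: "form v w = 0" "form (\<nu> v) w = 0" "form (\<nu> (\<nu> v)) w = 0"
    and nu_w: "\<nu> w = 0\<^sub>v 4"
begin

definition frame :: "'a mat" where
  "frame = mat_of_cols 4 [v, \<nu> v, \<nu> (\<nu> v), w]"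

lemma frame_carrier [simp]: "frame \<in> carrier_mat 4 4"
  by (rule carrier_matI) (simp_all add: frame_def)

lemma col_frame:
  "col frame 0 = v" "col frame 1 = \<nu> v" "col frame 2 = \<nu> (\<nu> v)" "col frame 3 = w"
  by (simp_all add: frame_def del: One_nat_def)

text \<open>The isometry itself supplies an element of trace 1, the scalar from which the involution is built.\<close>

lemma trace_b: "form v (\<nu> v) + form (\<nu> v) v = 1"
  by (simp add: form_nu_left cyclic char2_simps)

lemma orthogonal': "form w v = 0" "form w (\<nu> v) = 0" "form w (\<nu> (\<nu> v)) = 0"
  using orthogonal bar_form[OF v w] bar_form[OF _ w, of "\<nu> v"] bar_form[OF _ w, of "\<nu> (\<nu> v)"]
  by (simp_all add: zero_power)

lemma frame_gram:
  "adj frame * frame = model_gram (form v v) (form v (\<nu> v)) (form (\<nu> v) v) (form w w)"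
proof (rule mat4_eqI)
  fix i j :: nat
  assume ij: "i \<in> {0, 1, 2, 3}" "j \<in> {0, 1, 2, 3}"
  then have "(adj frame * frame) $$ (i, j) = form (col frame i) (col frame j)"
    by (intro form_gram[OF frame_carrier]) auto
  also have "\<dots> = model_gram (form v v) (form v (\<nu> v)) (form (\<nu> v) v) (form w w) $$ (i, j)"
    using ij
    by (elim insertE emptyE)
      (simp_all add: col_frame[simplified] model_gram_def mat_of_rows_list_def form_nu_nu cyclic
        orthogonal orthogonal' cube form_zero_right)
  finally show "(adj frame * frame) $$ (i, j) =
    model_gram (form v v) (form v (\<nu> v)) (form (\<nu> v) v) (form w w) $$ (i, j)" .
qed (simp_all add: mult_carrier_mat[of _ 4 4])

lemma frame_intertwines: "(1\<^sub>m 4 + N) * frame = frame * model_unipotent"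
proof (rule mat4_eqI)
  have J: "(model_unipotent :: 'a mat) \<in> carrier_mat 4 4" by simp
  fix i j :: nat
  assume ij: "i \<in> {0, 1, 2, 3}" "j \<in> {0, 1, 2, 3}"
  then have lt: "i < 4" "j < 4" by auto
  have "((1\<^sub>m 4 + N) * frame) $$ (i, j) = col ((1\<^sub>m 4 + N) * frame) j $ i"
    using lt carrier_matD[OF N] carrier_matD[OF frame_carrier] by (subst index_col) simp_all
  also have "col ((1\<^sub>m 4 + N) * frame) j = (1\<^sub>m 4 + N) *\<^sub>v col frame j"
    by (rule col_mult2[of _ 4 4 _ 4]) (simp_all add: lt)
  also have "\<dots> = col frame j + \<nu> (col frame j)"
    by (rule unipotent_apply) (use lt frame_carrier in \<open>auto intro: col_carrier_vec\<close>)
  also have "\<dots> $ i = (\<Sum>l \<leftarrow> [0, 1, 2, 3]. col frame l $ i * model_unipotent $$ (l, j))"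
    using ij lt(1)
    by (elim insertE[of j] emptyE)
      (simp_all add: col_frame[simplified] model_unipotent_def mat_of_rows_list_def cube nu_w
        carrier_matD[OF N] carrier_vecD[OF w])
  also have "\<dots> = (\<Sum>l = 0..<4. frame $$ (i, l) * model_unipotent $$ (l, j))"
    using lt frame_carrier by (simp add: eval_nat_numeral)
  also have "\<dots> = (frame * model_unipotent) $$ (i, j)"
    using lt carrier_matD[OF frame_carrier] carrier_matD[OF J] by (auto simp: scalar_prod_def intro!: sum.cong)
  finally show "((1\<^sub>m 4 + N) * frame) $$ (i, j) = (frame * model_unipotent) $$ (i, j)" .
qed (simp_all add: mult_carrier_mat[of _ 4 4])

text \<open>If \<open>w\<close> were isotropic, then the Gram matrix and hence the frame would be singular. But a linear
relation between the frame vectors is killed by the Gram matrix, whose first three rows make the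
coefficients at \<open>v, Nv, N\<^sup>2v\<close> vanish; this leaves only a multiple of \<open>w\<close>.\<close>

lemma anisotropic_w:
  assumes w0: "w \<noteq> 0\<^sub>v 4"
  shows "form w w \<noteq> 0"
proof
  assume ww: "form w w = 0"
  let ?G = "model_gram (form v v) (form v (\<nu> v)) (form (\<nu> v) v) (form w w)"
  have G_last: "?G *\<^sub>v unit_vec 4 3 = 0\<^sub>v 4"
    by (rule eq_vecI) (auto simp: ww model_gram_def mat_of_rows_list_def numeral_eq_Suc less_Suc_eq)
  have "det ?G = 0"
    unfolding det_0_iff_vec_prod_zero[OF model_carrier(1)] using G_last
    by (intro exI[of _ "unit_vec 4 3"]) simp
  then have "det (adj frame) * det frame = 0"
    by (simp add: frame_gram[symmetric] det_mult[OF adj_carrier[OF frame_carrier] frame_carrier])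
  moreover have "det (adj frame) = bar (det frame)"
    using frame_carrier by (simp add: bar_mat_def det_transpose[of _ 4])
  ultimately have "det frame = 0"
    by (auto simp: zero_power)
  then obtain x where x: "x \<in> carrier_vec 4" "x \<noteq> 0\<^sub>v 4" "frame *\<^sub>v x = 0\<^sub>v 4"
    unfolding det_0_iff_vec_prod_zero[OF frame_carrier] by blast
  have "?G *\<^sub>v x = adj frame *\<^sub>v (frame *\<^sub>v x)"
    unfolding frame_gram[symmetric] using x by (simp add: assoc_mult_mat_vec[of _ 4 4 _ 4])
  also have "\<dots> = 0\<^sub>v 4"
    unfolding x(3) by (rule mult_mat_zero_vec[OF adj_carrier[OF frame_carrier]])
  finally have Gx: "(?G *\<^sub>v x) $ i = 0" if "i < 4" for i
    using that by simp
  have x012: "x $ 0 = 0" "x $ 1 = 0" "x $ 2 = 0"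
    using Gx[of 2] Gx[of 1] Gx[of 0] x(1)
    by (simp_all add: model_gram_def mat_of_rows_list_def scalar_prod_def eval_nat_numeral)
  have "(frame *\<^sub>v x) $ i = x $ 3 * w $ i" if "i < 4" for i
  proof -
    have "(frame *\<^sub>v x) $ i = (\<Sum>l = 0..<4. frame $$ (i, l) * x $ l)"
      using that x(1) carrier_matD[OF frame_carrier] by (simp add: scalar_prod_def)
    also have "\<dots> = x $ 3 * frame $$ (i, 3)"
      using x012 by (simp add: eval_nat_numeral)
    also have "frame $$ (i, 3) = w $ i"
      using that by (simp add: frame_def mat_of_cols_index)
    finally show ?thesis .
  qed
  moreover obtain i where "i < 4" "w $ i \<noteq> 0"
    using w0 w by (metis eq_vecI index_zero_vec carrier_vecD)
  ultimately have "x $ 3 = 0"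
    using x(3) by force
  then have "x = 0\<^sub>v 4"
    using x(1) x012 by (intro eq_vecI) (auto simp: numeral_eq_Suc less_Suc_eq)
  with x(2) show False by simp
qed

end

text \<open>Three linear conditions on four coordinates have a nonzero solution. The orthogonal space is invariant
under \<open>N\<close>, because the adjoint of \<open>N\<close> is a polynomial in \<open>N\<close>; so the last nonzero vector among
\<open>x, Nx, N\<^sup>2x\<close> is a solution in the kernel of \<open>N\<close>.\<close>

lemma (in unipotent_isometry) obtain_orthogonal_vector:
  assumes n: "n = 4" and v: "v \<in> carrier_vec n"
  obtains w where "w \<in> carrier_vec n" "w \<noteq> 0\<^sub>v n" "\<nu> w = 0\<^sub>v n"
    "form v w = 0" "form (\<nu> v) w = 0" "form (\<nu> (\<nu> v)) w = 0"
proof -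
  define W where "W = {x \<in> carrier_vec n. x \<noteq> 0\<^sub>v n \<and>
    form v x = 0 \<and> form (\<nu> v) x = 0 \<and> form (\<nu> (\<nu> v)) x = 0}"
  have step: "\<nu> x \<in> W" if "x \<in> W" "\<nu> x \<noteq> 0\<^sub>v n" for x
    using that v by (simp add: W_def form_nu_right cube form_zero_left)
  \<comment> \<open>The zero row makes the system of three equations square, and visibly singular.\<close>
  let ?us = "map (map_vec bar) [v, \<nu> v, \<nu> (\<nu> v)] @ [0\<^sub>v n]"
  define M where "M = mat_of_rows n ?us"
  have M: "M \<in> carrier_mat n n" by (rule carrier_matI) (simp_all add: M_def n)
  have us: "set ?us \<subseteq> carrier_vec n" using v by auto
  have row_M: "row M i = ?us ! i" if "i < 4" for i
    using that us nth_mem[of i ?us] unfolding M_def by (intro mat_of_rows_row) auto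
  have "det (transpose_mat M) = 0"
    unfolding det_0_iff_vec_prod_zero[OF transpose_carrier_mat[THEN iffD2, OF M]]
  proof (intro exI conjI)
    show "transpose_mat M *\<^sub>v unit_vec n 3 = 0\<^sub>v n"
    proof (rule eq_vecI)
      fix i assume i: "i < dim_vec (0\<^sub>v n :: 'a vec)"
      then have "(transpose_mat M *\<^sub>v unit_vec n 3) $ i = row M 3 $ i"
        using M n by simp
      then show "(transpose_mat M *\<^sub>v unit_vec n 3) $ i = 0\<^sub>v n $ i"
        using i by (simp add: row_M)
    qed (use M in simp)
  qed (use n in simp_all)
  then have "det M = 0" using det_transpose[OF M] by simp
  then obtain x where x: "x \<in> carrier_vec n" "x \<noteq> 0\<^sub>v n" "M *\<^sub>v x = 0\<^sub>v n"
    unfolding det_0_iff_vec_prod_zero[OF M] by blast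
  have "?us ! i \<bullet> x = 0" if "i < 4" for i
    using arg_cong[OF x(3), of "\<lambda>y. y $ i"] that M unfolding row_M[OF that, symmetric] by (simp add: n)
  from this[of 0] this[of 1] this[of 2] have "x \<in> W"
    using x(1,2) by (simp add: W_def form_def)
  then obtain w where "w \<in> W" "\<nu> w = 0\<^sub>v n"
    using step[of x] step[of "\<nu> x"] cube[OF x(1)] by metis
  then show ?thesis using that unfolding W_def by blast
qed

section \<open>The inverting involution\<close>

context unipotent_isometry_frame
begin

text \<open>The model matrices are transported along the frame \<open>P\<close>. Its inverse \<open>R\<close> is written with the Gram
matrix, \<open>R = H * adj P\<close>, where \<open>H\<close> is the inverse of \<open>G\<close>, so that the invertibility of \<open>P\<close> comes for free.\<close>

lemma obtain_inverting_involution: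
  assumes ww: "form w w = 1"
  obtains s where "s \<in> carrier_mat 4 4" "adj s * s = 1\<^sub>m 4" "s * s = 1\<^sub>m 4"
    "s * (1\<^sub>m 4 + N) * (s * (1\<^sub>m 4 + N)) = 1\<^sub>m 4"
proof -
  define a b c where "a = form v v" and "b = form v (\<nu> v)" and "c = form (\<nu> v) v"
  define G where "G = model_gram a b c 1"
  define S where "S = model_involution b c"
  define J :: "'a mat" where "J = model_unipotent"
  define H where "H = mat4 [[0, 0, 1, 0], [0, 1, c, 0], [1, b, a + b * c, 0], [0, 0, 0, 1]]"
  define P where "P = frame"
  define R where "R = H * adj P"
  have bc: "b + c = 1" by (simp add: b_def c_def trace_b)
  have bar_bc: "bar b = c" "bar c = b"
    by (simp_all add: b_def c_def bar_form[of _ 4])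
  have carriers [simp]: "G \<in> carrier_mat 4 4" "S \<in> carrier_mat 4 4" "J \<in> carrier_mat 4 4"
    "P \<in> carrier_mat 4 4" "H \<in> carrier_mat 4 4" "adj P \<in> carrier_mat 4 4" "adj S \<in> carrier_mat 4 4"
    by (simp_all add: G_def S_def J_def P_def H_def mat4_carrier)
  have R [simp]: "R \<in> carrier_mat 4 4" "adj R \<in> carrier_mat 4 4"
    by (simp_all add: R_def mult_carrier_mat[of _ 4 4])
  note closed = mult_carrier_mat[of _ 4 4 _ 4]
  note assoc = assoc_mult_mat[of _ 4 4 _ 4 _ 4]
  have gram: "adj P * P = G"
    by (simp add: P_def G_def frame_gram ww a_def b_def c_def)
  have "G * H = 1\<^sub>m 4"
    unfolding G_def H_def by (rule model_gram_inverse[OF char2 bc])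
  then have "adj P * (P * H) = 1\<^sub>m 4"
    using gram by (simp add: assoc[symmetric])
  then have PR: "P * R = 1\<^sub>m 4"
    using mat_mult_left_right_inverse[of "adj P" 4 "P * H"] by (simp add: R_def closed assoc)
  then have RP: "R * P = 1\<^sub>m 4"
    using mat_mult_left_right_inverse[of P 4 R] by simp
  have cancel: "A * (B * X) = C * X"
    if "A * B = C" "A \<in> carrier_mat 4 4" "B \<in> carrier_mat 4 4" "X \<in> carrier_mat 4 4"
    for A B C X :: "'a mat"
    using assoc[OF that(2-4)] that(1) by simp
  have RP_cancel: "R * (P * X) = X" if "X \<in> carrier_mat 4 4" for X
    using cancel[OF RP _ _ that] that by simp
  have SS: "S * S = 1\<^sub>m 4"
    unfolding S_def by (rule model_involution_square[OF char2 bc])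
  have SJSJ: "S * (J * (S * J)) = 1\<^sub>m 4"
    using model_involution_inverts[OF char2 bc] by (simp add: S_def[symmetric] J_def[symmetric] closed assoc)
  have SGS: "adj S * (G * S) = G"
    using model_involution_isometry[OF char2 bc q_pos bar_bc, of a]
    by (simp add: S_def[symmetric] G_def[symmetric] assoc)
  have gP: "(1\<^sub>m 4 + N) * P = P * J"
    by (simp add: P_def J_def frame_intertwines)
  have g: "1\<^sub>m 4 + N = P * (J * R)"
    using arg_cong[OF gP, of "\<lambda>X. X * R"] PR
      right_mult_one_mat[of "1\<^sub>m 4 + N" 4 4] by (simp add: assoc)
  define s where "s = P * (S * R)"
  have adj_s: "adj s = adj R * (adj S * adj P)"
    by (simp add: s_def adj_mult[of _ 4 4 _ 4] closed assoc)
  show ?thesis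
  proof (rule that)
    show "s \<in> carrier_mat 4 4" by (simp add: s_def closed)
    have "s * s = P * (S * (S * R))"
      by (simp add: s_def assoc closed RP_cancel)
    also have "\<dots> = 1\<^sub>m 4" by (simp add: cancel[OF SS] left_mult_one_mat[of _ 4 4] PR)
    finally show "s * s = 1\<^sub>m 4" .
    have "s * (1\<^sub>m 4 + N) = P * (S * (J * R))"
      by (simp add: g s_def assoc closed RP_cancel)
    then have "s * (1\<^sub>m 4 + N) * (s * (1\<^sub>m 4 + N)) = P * (S * (J * (S * J)) * R)"
      by (simp add: assoc closed RP_cancel)
    then show "s * (1\<^sub>m 4 + N) * (s * (1\<^sub>m 4 + N)) = 1\<^sub>m 4"
      by (simp add: SJSJ left_mult_one_mat[of _ 4 4] PR)
    have "adj s * s = adj R * (adj S * (adj P * (P * (S * R))))"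
      unfolding adj_s by (simp add: s_def assoc closed)
    also have "\<dots> = adj R * (adj S * (G * S) * R)"
      by (simp add: cancel[OF gram] assoc closed)
    also have "\<dots> = adj R * (adj P * (P * R))"
      by (simp add: SGS cancel[OF gram])
    also have "\<dots> = adj R * adj P"
      unfolding PR by (rule arg_cong[OF right_mult_one_mat[of _ 4]]) simp
    also have "\<dots> = 1\<^sub>m 4"
      using adj_mult[of P 4 4 R 4] by (simp add: PR)
    finally show "adj s * s = 1\<^sub>m 4" .
  qed
qed

end

section \<open>Strong reality in the unitary group\<close>

context quadratic_field_char2
begin

lemma mem_unitary_group_iff:
  "A \<in> carrier (unitary_group n q) \<longleftrightarrow> A \<in> carrier_mat n n \<and> adj A * A = (1\<^sub>m n :: 'a mat)"
proof -
  have "\<exists>B \<in> carrier_mat n n. B * A = 1\<^sub>m n \<and> A * B = 1\<^sub>m n"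
    if "A \<in> carrier_mat n n" "adj A * A = 1\<^sub>m n"
    using that mat_mult_left_right_inverse[OF adj_carrier[OF that(1)] that] adj_carrier[OF that(1)]
    by blast
  then show ?thesis
    by (auto simp: unitary_group_def general_linear_group_def units_of_def Units_def ring_mat_def)
qed

text \<open>The inverting condition is given in the form \<open>(sg)\<^sup>2 = 1\<close>, which mentions no inverse; it says that
\<open>sgs\<close> is a left inverse of \<open>g\<close>, and square matrices have two-sided inverses.\<close>

lemma strongly_real_unitaryI:
  assumes g: "g \<in> carrier (unitary_group n q)"
    and s: "s \<in> carrier_mat n n" "adj s * s = (1\<^sub>m n :: 'a mat)"
    and involution: "s * s = 1\<^sub>m n"
    and inverts: "s * g * (s * g) = 1\<^sub>m n"
  shows "strongly_real (unitary_group n q) g"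
proof -
  let ?U = "unitary_group n q :: 'a mat monoid"
  have U_ops: "x \<otimes>\<^bsub>?U\<^esub> y = x * y" "\<one>\<^bsub>?U\<^esub> = 1\<^sub>m n" for x y
    by (simp_all add: unitary_group_def general_linear_group_def units_of_def ring_mat_def)
  have closed: "A * B \<in> carrier ?U" if "A \<in> carrier ?U" "B \<in> carrier ?U" for A B
  proof -
    from that have A: "A \<in> carrier_mat n n" "adj A * A = 1\<^sub>m n"
      and B: "B \<in> carrier_mat n n" "adj B * B = 1\<^sub>m n"
      by (simp_all add: mem_unitary_group_iff)
    note assoc = assoc_mult_mat[of _ n n _ n _ n]
    have "adj (A * B) * (A * B) = adj B * (adj A * A * B)"
      using A(1) B(1) adj_carrier[OF A(1)] adj_carrier[OF B(1)]
      by (simp add: adj_mult[of _ n n _ n] assoc mult_carrier_mat[of _ n n _ n])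
    then show ?thesis
      using A B by (simp add: mem_unitary_group_iff)
  qed
  have gc: "g \<in> carrier_mat n n" using g by (simp add: mem_unitary_group_iff)
  have sU: "s \<in> carrier ?U" using s by (simp add: mem_unitary_group_iff)
  have sgsU: "s * g * s \<in> carrier ?U" by (intro closed sU g)
  have sgs: "s * g * s \<in> carrier_mat n n" using s(1) gc by simp
  have left: "s * g * s * g = 1\<^sub>m n"
    using inverts s(1) gc by (simp add: assoc_mult_mat[of _ n n _ n _ n])
  have right: "g * (s * g * s) = 1\<^sub>m n"
    by (rule mat_mult_left_right_inverse[OF sgs gc left])
  have "inv\<^bsub>?U\<^esub> g = s * g * s"
    unfolding m_inv_def U_ops
  proof (rule the_equality)
    show "s * g * s \<in> carrier ?U \<and> g * (s * g * s) = 1\<^sub>m n \<and> s * g * s * g = 1\<^sub>m n"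
      using sgsU left right by blast
  next
    fix y assume y: "y \<in> carrier ?U \<and> g * y = 1\<^sub>m n \<and> y * g = 1\<^sub>m n"
    then have yc: "y \<in> carrier_mat n n" by (simp add: mem_unitary_group_iff)
    have "y = (s * g * s * g) * y" using left yc by simp
    also have "\<dots> = s * g * s * (g * y)" by (rule assoc_mult_mat[OF sgs gc yc])
    finally show "y = s * g * s" using y right_mult_one_mat[OF sgs] by metis
  qed
  then show ?thesis
    unfolding strongly_real_def U_ops using sU involution by (intro bexI[of _ s]) auto
qed

text \<open>This is the theorem with the type replaced by what it says about \<open>N = g - 1\<close>: a suitable frame
exists, first with some \<open>w\<close> and then with a \<open>w\<close> of norm 1.\<close>

lemma strongly_real_if_nilpotency_index_3:
  assumes gU: "g \<in> carrier (unitary_group 4 q :: 'a mat monoid)"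
    and cube: "(g - 1\<^sub>m 4) ^\<^sub>m 3 = 0\<^sub>m 4 4" and square: "(g - 1\<^sub>m 4) ^\<^sub>m 2 \<noteq> 0\<^sub>m 4 4"
  shows "strongly_real (unitary_group 4 q) g"
proof -
  define N where "N = g - 1\<^sub>m 4"
  from gU have g: "g \<in> carrier_mat 4 4" "adj g * g = 1\<^sub>m 4"
    by (simp_all add: mem_unitary_group_iff)
  have N: "N \<in> carrier_mat 4 4" by (simp add: N_def minus_carrier_mat)
  have g_eq: "1\<^sub>m 4 + N = g"
    using g by (auto intro!: eq_matI simp: N_def)
  have power_apply: "N ^\<^sub>m 3 *\<^sub>v x = N *\<^sub>v (N *\<^sub>v (N *\<^sub>v x))"
    "N ^\<^sub>m 2 *\<^sub>v x = N *\<^sub>v (N *\<^sub>v x)" if "x \<in> carrier_vec 4" for x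
    using N that by (simp_all add: eval_nat_numeral assoc_mult_mat_vec[of _ 4 4 _ 4] mult_carrier_mat[of _ 4 4])
  interpret unipotent_isometry k q ty 4 N
  proof
    show "N \<in> carrier_mat 4 4" by (rule N)
    show "adj (1\<^sub>m 4 + N) * (1\<^sub>m 4 + N) = 1\<^sub>m 4" using g g_eq by simp
    show "N *\<^sub>v (N *\<^sub>v (N *\<^sub>v x)) = 0\<^sub>v 4" if "x \<in> carrier_vec 4" for x
      using power_apply(1)[OF that] cube that by (simp add: N_def[symmetric] zero_mat_mult_vec)
  qed
  have "\<exists>x \<in> carrier_vec 4. \<nu> (\<nu> x) \<noteq> 0\<^sub>v 4"
  proof (rule ccontr)
    assume "\<not> ?thesis"
    then have zero: "N ^\<^sub>m 2 *\<^sub>v x = 0\<^sub>v 4" if "x \<in> carrier_vec 4" for x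
      using that power_apply(2) by simp
    have "N ^\<^sub>m 2 = 0\<^sub>m 4 4"
    proof (rule eq_matI)
      fix i j :: nat
      assume "i < dim_row (0\<^sub>m 4 4 :: 'a mat)" "j < dim_col (0\<^sub>m 4 4 :: 'a mat)"
      then show "(N ^\<^sub>m 2) $$ (i, j) = 0\<^sub>m 4 4 $$ (i, j)"
        using arg_cong[OF zero[of "unit_vec 4 j"], of "\<lambda>x. x $ i"] carrier_matD[OF pow_carrier_mat[OF N, of 2]]
        by simp
    qed (use carrier_matD[OF pow_carrier_mat[OF N, of 2]] in simp_all)
    with square show False by (simp add: N_def)
  qed
  then obtain v where v: "v \<in> carrier_vec 4" "form v (\<nu> (\<nu> v)) = 1"
    using obtain_cyclic_vector by metis
  obtain x where x: "x \<in> carrier_vec 4" "x \<noteq> 0\<^sub>v 4" "\<nu> x = 0\<^sub>v 4"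
    "form v x = 0" "form (\<nu> v) x = 0" "form (\<nu> (\<nu> v)) x = 0"
    using obtain_orthogonal_vector[OF refl v(1)] by metis
  interpret X: unipotent_isometry_frame k q ty N v x
    by unfold_locales (use v x in auto)
  have "bar (form x x) = form x x" using x(1) by (simp add: bar_form[of _ 4])
  then obtain r where r: "bar r = r" "r\<^sup>2 = form x x" by (rule fixed_square_root)
  have r0: "r \<noteq> 0" using r(2) X.anisotropic_w[OF x(2)] by auto
  define w where "w = (1 / r) \<cdot>\<^sub>v x"
  have w: "w \<in> carrier_vec 4" using x(1) by (simp add: w_def)
  interpret W: unipotent_isometry_frame k q ty N v w
    by unfold_locales (use v x in \<open>auto simp: w_def form_smult[of _ 4] mult_mat_vec[OF N]\<close>)
  have "form w w = 1"
    using x(1) r r0 by (simp add: w_def form_smult[of _ 4] power_one_over power2_eq_square flip: r(2))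
  then obtain s where "s \<in> carrier_mat 4 4" "adj s * s = 1\<^sub>m 4" "s * s = 1\<^sub>m 4"
    "s * g * (s * g) = 1\<^sub>m 4"
    using W.obtain_inverting_involution unfolding g_eq by metis
  then show ?thesis by (rule strongly_real_unitaryI[OF gU])
qed

end

theorem proposition6p1:
  fixes q k :: nat and g :: "'a :: {field, finite} mat"
  assumes "k \<ge> 1" and "q = 2 ^ k"
    and "CARD('a) = q\<^sup>2"
    and "g \<in> carrier (unitary_group 4 q)"
    and "unipotent_of_type {#3, 1#} g"
  shows "strongly_real (unitary_group 4 q) g"
proof -
  interpret quadratic_field_char2 k q "TYPE('a)"
    by unfold_locales (use assms in auto)
  have "g \<in> carrier_mat 4 4"
    using assms(4) by (simp add: mem_unitary_group_iff)
  note power_zero_iff = unipotent_of_type_pow_zero_iff[OF this assms(5)]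
  show ?thesis
    by (rule strongly_real_if_nilpotency_index_3[OF assms(4)]) (simp_all add: power_zero_iff)
qed

end
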